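(* Let $n,k,a,b$ be positive integers with $k \mid n$, $n\geq 5k$ and $k=a+b$. Let $\mathcal{H}\subseteq \binom{[n]}{k}$ be a $k$-uniform hypergraph on vertex set $[n]$. If there exists $\alpha\in(0,1)$ such that \[ \delta_a(\mathcal{H})\geq \Big(\alpha+4\sqrt{k\log n/n}\Big)\binom{n-a}{b} \quad\text{and}\quad \delta_b(\mathcal{H})\geq \Big(1-\alpha+4\sqrt{k\log n/n}\Big)\binom{n-b}{a}, \] then $\mathcal{H}$ contains a Hamilton $(a,b)$-cycle.
   Context: $[n]=\{1,\dots,n\}$ and $\binom{[n]}{k}$ is the family of all $k$-subsets of $[n]$; a subfamily $\mathcal{H}\subseteq\binom{[n]}{k}$ is regarded as a $k$-uniform hypergraph with vertex set $[n]$ and edge set $\mathcal{H}$. For a $d$-subset $S\subseteq[n]$, $\deg_{\mathcal{H}}(S)$ is the number of edges of $\mathcal{H}$ containing $S$, and the minimum $d$-degree $\delta_d(\mathcal{H})$ is the minimum of $\deg_{\mathcal{H}}(S)$ over all $d$-subsets $S$ of $[n]$. For positive integers $a,b$ with $a+b=k$, a $k$-uniform hypergraph is an $(a,b)$-cycle if there is a partition $(A_0,B_0,A_1,B_1,\dots,A_{t-1},B_{t-1})$ of its vertex set with $|A_i|=a$, $|B_i|=b$ such that $A_i\cup B_i$ and $B_i\cup A_{i+1}$ (indices modulo $t$) are edges for all $i=0,\dots,t-1$. A hypergraph $\mathcal{H}$ contains a Hamilton $(a,b)$-cycle if some subhypergraph of $\mathcal{H}$ is an $(a,b)$-cycle covering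 all vertices of $\mathcal{H}$. *)

theory Defs
  imports "HOL-Analysis.Analysis"
begin

definition ksubsets :: "'a set \<Rightarrow> nat \<Rightarrow> 'a set set" where
  "ksubsets V k = {S. S \<subseteq> V \<and> card S = k}"

definition hdeg :: "'a set set \<Rightarrow> 'a set \<Rightarrow> nat" where
  "hdeg H S = card {e \<in> H. S \<subseteq> e}"

definition min_deg :: "'a set \<Rightarrow> 'a set set \<Rightarrow> nat \<Rightarrow> nat" where
  "min_deg V H d = Min (hdeg H ` ksubsets V d)"

definition has_hamilton_ab_cycle :: "'a set \<Rightarrow> 'a set set \<Rightarrow> nat \<Rightarrow> nat \<Rightarrow> bool" where
  "has_hamilton_ab_cycle V H a b \<longleftrightarrow>
     (\<exists>t::nat. \<exists>A B :: nat \<Rightarrow> 'a set. t \<ge> 1 \<and>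
        (\<forall>i<t. card (A i) = a \<and> card (B i) = b) \<and>
        (\<forall>i<t. \<forall>j<t. A i \<inter> B j = {}) \<and>
        (\<forall>i<t. \<forall>j<t. i \<noteq> j \<longrightarrow> A i \<inter> A j = {} \<and> B i \<inter> B j = {}) \<and>
        (\<Union>i<t. A i \<union> B i) = V \<and>
        (\<forall>i<t. A i \<union> B i \<in> H \<and> B i \<union> A ((i + 1) mod t) \<in> H))"

end

theory Submission
  imports Defs
begin

text \<open>Put \<open>t = n / k\<close> and split the vertices uniformly at random into \<open>t\<close> sets \<open>A\<^sub>i\<close> of size \<open>a\<close> and
  \<open>t\<close> sets \<open>B\<^sub>j\<close> of size \<open>b\<close>. A Hamilton cycle of the bipartite graph in which \<open>A\<^sub>i\<close> and \<open>B\<^sub>j\<close> are joined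
  when \<open>A\<^sub>i \<union> B\<^sub>j \<in> H\<close> is a Hamilton \<open>(a, b)\<close>-cycle of \<open>H\<close>. By the theorem of Moon and Moser it exists
  if every \<open>A\<^sub>i\<close> has degree at least \<open>\<alpha> t + 1/2\<close> and every \<open>B\<^sub>j\<close> at least \<open>(1 - \<alpha>) t + 1/2\<close>.
  Each of these \<open>2 t\<close> conditions fails with probability at most \<open>n\<^sup>-\<^sup>2\<close>: the blocks of a random
  partition satisfy \<open>E (\<Prod>\<^sub>j \<psi>\<^sub>j(B\<^sub>j)) \<le> \<Prod>\<^sub>j (E \<psi>\<^sub>j(B\<^sub>j)\<^sup>2)\<^sup>1\<^sup>/\<^sup>2\<close> for nonnegative \<open>\<psi>\<^sub>j\<close>, a substitute for
  independence that is strong enough for Chernoff's argument with parameter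
  \<open>s = (k log n / n)\<^sup>1\<^sup>/\<^sup>2\<close>.\<close>

subsection \<open>A numerical inequality\<close>

text \<open>This step adds an index of weight \<open>q\<close> to a family of total weight
  \<open>Q\<close> in \<open>prod_weighted_squares_lower\<close>; there \<open>w\<close> is the
  product of the \<open>y j\<close> so far and \<open>Q * z\<close> is the numerator. The right side
  minus the left is \<open>Q * q\<close> times (wy - zx)^2 + (zy - xw)^2 (1/(Q + q) - 1), which is
  nonnegative because \<open>Q + q \<le> 1\<close>.\<close>

lemma merge_weighted_squares:
  fixes x y z w Q q :: real
  assumes "0 < Q" "0 < q" "Q + q \<le> 1"
  shows "(1 - (Q + q)) * (w * y)\<^sup>2 + (q * x * w + y * (Q * z))\<^sup>2 / (Q + q)
    \<le> ((1 - Q) * w\<^sup>2 + (Q * z)\<^sup>2 / Q) * (q * x\<^sup>2 + (1 - q) * y\<^sup>2)" (is "?L \<le> ?R")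
proof -
  define u where "u = (z * y - x * w)\<^sup>2"
  have zQ: "(Q * z)\<^sup>2 / Q = Q * z\<^sup>2"
    using assms by (simp add: power2_eq_square)
  have "Q * q * ((w * y - z * x)\<^sup>2 + (u / (Q + q) - u)) \<ge> 0"
  proof -
    have "u * 1 \<le> u * (1 / (Q + q))"
      by (rule mult_left_mono) (use assms in \<open>auto simp: u_def\<close>)
    then have "u / (Q + q) - u \<ge> 0" by simp
    then show ?thesis using assms by (intro mult_nonneg_nonneg add_nonneg_nonneg) auto
  qed
  moreover have "(Q + q) * (?R - ?L) = (Q + q) * (Q * q * ((w * y - z * x)\<^sup>2 + (u / (Q + q) - u)))"
  proof -
    have d: "(Q + q) * (A / (Q + q)) = A" for A using assms by simp
    have "(Q + q) * (?R - ?L) = (Q + q) * (((1 - Q) * w\<^sup>2 + Q * z\<^sup>2) * (q * x\<^sup>2 + (1 - q) * y\<^sup>2)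
        - (1 - (Q + q)) * (w * y)\<^sup>2) - (q * x * w + y * (Q * z))\<^sup>2"
      unfolding zQ using d[of "(q * x * w + y * (Q * z))\<^sup>2"] by (simp add: algebra_simps)
    also have "\<dots> = Q * q * ((Q + q) * ((w * y - z * x)\<^sup>2 - u) + u)"
      unfolding u_def by algebra
    also have "\<dots> = (Q + q) * (Q * q * ((w * y - z * x)\<^sup>2 + (u / (Q + q) - u)))"
    proof -
      obtain r where r: "r = u / (Q + q)" by blast
      then have u: "u = (Q + q) * r" using d[of u] by simp
      show ?thesis unfolding r[symmetric] unfolding u by algebra
    qed
    finally show ?thesis .
  qed
  then have "?R - ?L = Q * q * ((w * y - z * x)\<^sup>2 + (u / (Q + q) - u))"
    using assms by simp
  ultimately show ?thesis by linarith
qed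

text \<open>When \<open>sum q J = 0\<close> the quotient is 0 by convention, and so is its numerator.\<close>

lemma prod_weighted_squares_lower:
  fixes q x y :: "'i \<Rightarrow> real"
  assumes "finite J" "\<And>j. j \<in> J \<Longrightarrow> 0 \<le> q j" "sum q J \<le> 1"
  shows "(1 - sum q J) * (\<Prod>j\<in>J. y j)\<^sup>2
      + (\<Sum>i\<in>J. q i * x i * (\<Prod>j\<in>J - {i}. y j))\<^sup>2 / sum q J
    \<le> (\<Prod>j\<in>J. q j * (x j)\<^sup>2 + (1 - q j) * (y j)\<^sup>2)"
  using assms
proof (induction J rule: finite_induct)
  case empty
  then show ?case by simp
next
  case (insert k J)
  define Q where "Q = sum q J"
  define w where "w = (\<Prod>j\<in>J. y j)"
  define S where "S = (\<Sum>i\<in>J. q i * x i * (\<Prod>j\<in>J - {i}. y j))"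
  define P where "P = (\<Prod>j\<in>J. q j * (x j)\<^sup>2 + (1 - q j) * (y j)\<^sup>2)"
  have qk: "0 \<le> q k" and Q0: "0 \<le> Q" and Qq: "Q + q k \<le> 1"
    using insert by (auto simp: Q_def intro: sum_nonneg)
  have IH: "(1 - Q) * w\<^sup>2 + S\<^sup>2 / Q \<le> P"
    using insert.IH insert.prems(1) qk Q0 Qq unfolding Q_def w_def S_def P_def by simp
  have "(\<Sum>i\<in>J. q i * x i * (\<Prod>j\<in>insert k J - {i}. y j)) = y k * S"
    unfolding S_def sum_distrib_left
  proof (rule sum.cong)
    fix i assume "i \<in> J"
    then have "insert k J - {i} = insert k (J - {i})" using insert.hyps by auto
    then show "q i * x i * (\<Prod>j\<in>insert k J - {i}. y j) = y k * (q i * x i * (\<Prod>j\<in>J - {i}. y j))"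
      using insert.hyps by simp
  qed simp
  then have S': "(\<Sum>i\<in>insert k J. q i * x i * (\<Prod>j\<in>insert k J - {i}. y j)) = q k * x k * w + y k * S"
    using insert.hyps by (simp add: w_def)
  have nonneg: "0 \<le> q k * (x k)\<^sup>2 + (1 - q k) * (y k)\<^sup>2"
    using qk Q0 Qq by auto
  have S0: "S = 0" if "Q = 0"
  proof -
    have "\<forall>i\<in>J. q i = 0"
      using that insert unfolding Q_def by (subst (asm) sum_nonneg_eq_0_iff) auto
    then show ?thesis by (simp add: S_def)
  qed
  have "(1 - (Q + q k)) * (w * y k)\<^sup>2 + (q k * x k * w + y k * S)\<^sup>2 / (Q + q k)
     \<le> ((1 - Q) * w\<^sup>2 + S\<^sup>2 / Q) * (q k * (x k)\<^sup>2 + (1 - q k) * (y k)\<^sup>2)"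
  \<comment> \<open>If one of the two weights is 0, the claim is an equality; merging needs both
    positive.\<close>
  proof (cases "Q = 0 \<or> q k = 0")
    case True
    then show ?thesis
    proof
      assume "Q = 0"
      then show ?thesis using S0 by (simp add: power2_eq_square algebra_simps)
    next
      assume "q k = 0"
      then show ?thesis by (simp add: power2_eq_square algebra_simps)
    qed
  next
    case False
    then show ?thesis
      using merge_weighted_squares[of Q "q k" w "y k" "x k" "S / Q"] qk Q0 Qq by simp
  qed
  also have "\<dots> \<le> P * (q k * (x k)\<^sup>2 + (1 - q k) * (y k)\<^sup>2)"
    by (rule mult_right_mono[OF IH nonneg])
  finally show ?case
    using insert.hyps S' by (simp add: P_def Q_def w_def algebra_simps)
qed

text \<open>At total weight 1 the first term of \<open>prod_weighted_squares_lower\<close> vanishes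
  and the quotient is a plain square. On the left exactly one index, drawn with probabilities
  \<open>q\<close>, contributes its \<open>x\<close>; on the right the choices between
  \<open>x j\<close> and \<open>y j\<close> are independent.\<close>

lemma sum_prod_le_sqrt_prod:
  fixes q x y :: "'i \<Rightarrow> real"
  assumes "finite J" "\<And>j. j \<in> J \<Longrightarrow> 0 \<le> q j" "sum q J = 1"
  shows "(\<Sum>i\<in>J. q i * x i * (\<Prod>j\<in>J - {i}. y j))
    \<le> sqrt (\<Prod>j\<in>J. q j * (x j)\<^sup>2 + (1 - q j) * (y j)\<^sup>2)"
  using prod_weighted_squares_lower[of J q y x] assms by (intro real_le_rsqrt) simp

subsection \<open>Random ordered partitions\<close>

text \<open>An ordered partition is stored as the map from vertices to class labels, so that
  revealing one vertex is a function update; extensionality makes this map unique. Classes of size 0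
  are allowed, since they arise in inductions on \<open>V\<close>.\<close>

definition colorings :: "'a set \<Rightarrow> 'i set \<Rightarrow> ('i \<Rightarrow> nat) \<Rightarrow> ('a \<Rightarrow> 'i) set" where
  "colorings V J b = {c \<in> V \<rightarrow>\<^sub>E J. \<forall>j\<in>J. card {v \<in> V. c v = j} = b j}"

lemma finite_colorings: "finite V \<Longrightarrow> finite J \<Longrightarrow> finite (colorings V J b)"
  unfolding colorings_def by (rule finite_subset[of _ "V \<rightarrow>\<^sub>E J"]) (auto intro: finite_PiE)

lemma finite_ksubsets: "finite V \<Longrightarrow> finite (ksubsets V k)"
  unfolding ksubsets_def by simp

lemma card_ksubsets: "finite V \<Longrightarrow> card (ksubsets V k) = card V choose k"
  unfolding ksubsets_def by (rule n_subsets)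

lemma fibre_insert:
  assumes "v \<notin> V"
  shows "{u \<in> insert v V. (c(v := i)) u = j} = (if j = i then insert v {u \<in> V. c u = j} else {u \<in> V. c u = j})"
  using assms by auto

text \<open>Deleting \<open>v\<close> from its class \<open>i\<close> leaves a colouring whose class
  \<open>i\<close> is one smaller, and \<open>i\<close> together with that colouring determines the
  original. The condition \<open>0 < b i\<close> reflects that the class contained
  \<open>v\<close>.\<close>

lemma colorings_insert:
  assumes "finite V" "v \<notin> V"
  shows "bij_betw (\<lambda>(i, c). c(v := i))
    (SIGMA i:{i \<in> J. 0 < b i}. colorings V J (b(i := b i - 1))) (colorings (insert v V) J b)"
proof (rule bij_betwI')
  fix p p' :: "'b \<times> ('a \<Rightarrow> 'b)"
  assume p: "p \<in> (SIGMA i:{i \<in> J. 0 < b i}. colorings V J (b(i := b i - 1)))"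
    and p': "p' \<in> (SIGMA i:{i \<in> J. 0 < b i}. colorings V J (b(i := b i - 1)))"
  have inj: "i = i' \<and> c = c'" if "c(v := i) = c'(v := i')" "c \<in> V \<rightarrow>\<^sub>E J" "c' \<in> V \<rightarrow>\<^sub>E J" for i i' c c'
  proof -
    have "c v = c' v" using PiE_arb[OF that(2) assms(2)] PiE_arb[OF that(3) assms(2)] by simp
    then have "c = c'" using that(1) by (metis fun_upd_idem fun_upd_upd)
    then show ?thesis using that(1) by (metis fun_upd_same)
  qed
  show "((case p of (i, c) \<Rightarrow> c(v := i)) = (case p' of (i, c) \<Rightarrow> c(v := i))) = (p = p')"
  proof
    assume "(case p of (i, c) \<Rightarrow> c(v := i)) = (case p' of (i, c) \<Rightarrow> c(v := i))"
    moreover have "snd p \<in> V \<rightarrow>\<^sub>E J" "snd p' \<in> V \<rightarrow>\<^sub>E J"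
      using p p' by (auto simp: colorings_def)
    ultimately show "p = p'"
      using inj[of "snd p" "fst p" "snd p'" "fst p'"] by (simp add: case_prod_beta prod_eq_iff)
  qed simp
next
  fix p :: "'b \<times> ('a \<Rightarrow> 'b)"
  assume p: "p \<in> (SIGMA i:{i \<in> J. 0 < b i}. colorings V J (b(i := b i - 1)))"
  obtain i c where [simp]: "p = (i, c)" by (cases p)
  have c: "i \<in> J" "0 < b i" "c \<in> V \<rightarrow>\<^sub>E J"
    "\<And>j. j \<in> J \<Longrightarrow> card {u \<in> V. c u = j} = (b(i := b i - 1)) j"
    using p by (auto simp: colorings_def)
  have "c(v := i) \<in> insert v V \<rightarrow>\<^sub>E J" using c by (auto simp: PiE_iff extensional_def)
  moreover have "card {u \<in> insert v V. (c(v := i)) u = j} = b j" if "j \<in> J" for j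
    unfolding fibre_insert[OF assms(2)] using c(4)[OF that] c(2) assms by (auto split: if_splits)
  ultimately show "(case p of (i, c) \<Rightarrow> c(v := i)) \<in> colorings (insert v V) J b"
    by (auto simp: colorings_def)
next
  fix d assume d: "d \<in> colorings (insert v V) J b"
  \<comment> \<open>Resetting \<open>v\<close> restores extensionality on \<open>V\<close>.\<close>
  define c where "c = d(v := undefined)"
  have dc: "d = c(v := d v)" by (simp add: c_def)
  have cP: "c \<in> V \<rightarrow>\<^sub>E J" and dv: "d v \<in> J"
    using d assms(2) by (auto simp: c_def colorings_def PiE_iff extensional_def)
  have cd: "card {u \<in> insert v V. (c(v := d v)) u = j} = b j" if "j \<in> J" for j
    using d that dc unfolding colorings_def by auto
  have "card {u \<in> V. c u = j} = (b(d v := b (d v) - 1)) j" if "j \<in> J" for j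
    using cd[OF that] assms unfolding fibre_insert[OF assms(2)] by (auto split: if_splits)
  moreover have "0 < b (d v)"
    using cd[OF dv] assms unfolding fibre_insert[OF assms(2)] by auto
  ultimately show "\<exists>p\<in>SIGMA i:{i \<in> J. 0 < b i}. colorings V J (b(i := b i - 1)).
      d = (case p of (i, c) \<Rightarrow> c(v := i))"
    using cP dv dc by (intro bexI[of _ "(d v, c)"]) (auto simp: colorings_def)
qed

lemma sum_colorings_insert:
  fixes f :: "('a \<Rightarrow> 'i) \<Rightarrow> 'c::comm_monoid_add"
  assumes "finite V" "v \<notin> V" "finite J"
  shows "sum f (colorings (insert v V) J b)
    = (\<Sum>i\<in>{i \<in> J. 0 < b i}. \<Sum>c\<in>colorings V J (b(i := b i - 1)). f (c(v := i)))"
  unfolding sum.reindex_bij_betw[OF colorings_insert[OF assms(1,2)], symmetric]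
  using assms by (subst sum.Sigma) (auto simp: finite_colorings case_prod_beta)

lemma sum_fun_upd_pred:
  fixes b :: "'i \<Rightarrow> nat"
  assumes "finite J" "i \<in> J" "0 < b i"
  shows "sum (b(i := b i - 1)) J = sum b J - 1"
proof -
  have "sum (b(i := b i - 1)) (J - {i}) = sum b (J - {i})" by (rule sum.cong) auto
  then show ?thesis using assms by (simp add: sum.remove[of J i])
qed

lemma prod_fact_pred:
  assumes "finite J" "i \<in> J" "0 < b i"
  shows "(\<Prod>j\<in>J. fact (b j)) = b i * (\<Prod>j\<in>J. fact ((b(i := b i - 1)) j) :: nat)"
proof -
  have "(\<Prod>j\<in>J - {i}. fact ((b(i := b i - 1)) j)) = (\<Prod>j\<in>J - {i}. fact (b j) :: nat)"
    by (rule prod.cong) auto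
  then show ?thesis
    using assms by (simp add: prod.remove[of J i] fact_reduce)
qed

text \<open>The multinomial coefficient, multiplied out to avoid division. The class
  \<open>i\<close> of the new vertex contributes a factor \<open>b i\<close>, and these factors add
  up to the number of vertices.\<close>

lemma card_colorings:
  fixes V :: "'a set"
  assumes "finite V" "finite J" "sum b J = card V"
  shows "card (colorings V J b) * (\<Prod>j\<in>J. fact (b j)) = (fact (card V) :: nat)"
  using assms
proof (induction V arbitrary: b rule: finite_induct)
  case empty
  then have "\<forall>j\<in>J. b j = 0" by simp
  then have "colorings ({} :: 'a set) J b = {\<lambda>_. undefined}" by (auto simp: colorings_def)
  then show ?case using \<open>\<forall>j\<in>J. b j = 0\<close> by simp
next
  case (insert v V)
  have step: "card (colorings V J (b(i := b i - 1))) * (\<Prod>j\<in>J. fact (b j)) = b i * fact (card V)"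
    if i: "i \<in> J" "0 < b i" for i
  proof -
    have "(\<Prod>j\<in>J. fact (b j)) = b i * (\<Prod>j\<in>J. fact ((b(i := b i - 1)) j) :: nat)"
      using \<open>finite J\<close> i by (rule prod_fact_pred)
    moreover have "sum (b(i := b i - 1)) J = card V"
      using insert.prems insert.hyps sum_fun_upd_pred[of J i b] i by simp
    ultimately show ?thesis
      using insert.IH[of "b(i := b i - 1)"] insert.prems by (metis mult.left_commute)
  qed
  have "card (colorings (insert v V) J b) * (\<Prod>j\<in>J. fact (b j))
      = (\<Sum>i\<in>{i \<in> J. 0 < b i}. card (colorings V J (b(i := b i - 1))) * (\<Prod>j\<in>J. fact (b j)))"
    using sum_colorings_insert[OF insert.hyps(1,2) \<open>finite J\<close>, of "\<lambda>_. 1::nat" b]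
    by (simp add: sum_distrib_right)
  also have "\<dots> = (\<Sum>i\<in>{i \<in> J. 0 < b i}. b i * fact (card V))"
    using step by (intro sum.cong) auto
  also have "\<dots> = (\<Sum>i\<in>{i \<in> J. 0 < b i}. b i) * fact (card V)"
    by (simp add: sum_distrib_right)
  also have "(\<Sum>i\<in>{i \<in> J. 0 < b i}. b i) = sum b J"
    by (rule sum.mono_neutral_left) (use \<open>finite J\<close> in auto)
  finally show ?case using insert by simp
qed

lemma card_colorings_pos:
  assumes "finite V" "finite J" "sum b J = card V"
  shows "0 < card (colorings V J b)"
  using card_colorings[OF assms] by (metis fact_nonzero gr0I mult_0)

text \<open>A quotient of two multinomial coefficients: a fixed vertex lies in class
  \<open>i\<close> with probability \<open>b i\<close> over the number of vertices.\<close>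

lemma card_colorings_pred:
  assumes "finite V" "v \<notin> V" "finite J" "sum b J = Suc (card V)" "i \<in> J" "0 < b i"
  shows "card (colorings V J (b(i := b i - 1))) * Suc (card V) = b i * card (colorings (insert v V) J b)"
proof -
  let ?P = "\<lambda>b. \<Prod>j\<in>J. fact (b j) :: nat"
  have P: "?P b = b i * ?P (b(i := b i - 1))"
    using assms(3,5,6) by (rule prod_fact_pred)
  have "card (colorings V J (b(i := b i - 1))) * ?P (b(i := b i - 1)) = fact (card V)"
    using assms sum_fun_upd_pred[of J i b] by (intro card_colorings) auto
  moreover have "card (colorings (insert v V) J b) * ?P b = fact (Suc (card V))"
    using assms card_colorings[of "insert v V" J b] by simp
  ultimately have "card (colorings V J (b(i := b i - 1))) * Suc (card V) * ?P (b(i := b i - 1))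
     = b i * card (colorings (insert v V) J b) * ?P (b(i := b i - 1))"
    using P by (simp add: algebra_simps)
  moreover have "?P (b(i := b i - 1)) > 0" by (simp add: prod_pos)
  ultimately show ?thesis by simp
qed

section \<open>Averages over sets of fixed size\<close>

text \<open>Over the empty set the value is 0 by the convention for division. This happens for
  \<open>ksubsets V k\<close> with \<open>k = Suc (card V)\<close> in
  \<open>avg_ksubsets_insert\<close>, where the coefficient is 0 as well.\<close>

definition avg :: "'b set \<Rightarrow> ('b \<Rightarrow> real) \<Rightarrow> real" where
  "avg S f = sum f S / real (card S)"

lemma avg_nonneg: "(\<And>x. x \<in> S \<Longrightarrow> 0 \<le> f x) \<Longrightarrow> 0 \<le> avg S f"
  unfolding avg_def by (intro divide_nonneg_nonneg sum_nonneg) auto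

lemma ksubsets_0: "finite V \<Longrightarrow> ksubsets V 0 = {{}}"
  unfolding ksubsets_def by (auto dest: finite_subset)

lemma sum_ksubsets_insert:
  assumes "finite V" "v \<notin> V"
  shows "sum g (ksubsets (insert v V) (Suc k))
    = (\<Sum>B\<in>ksubsets V k. g (insert v B)) + sum g (ksubsets V (Suc k))"
proof -
  have eq: "ksubsets (insert v V) (Suc k) = insert v ` ksubsets V k \<union> ksubsets V (Suc k)"
    (is "?L = ?R")
  proof
    show "?L \<subseteq> ?R"
    proof
      fix B assume B: "B \<in> ?L"
      then have fin: "finite B" using assms by (auto simp: ksubsets_def intro: finite_subset)
      show "B \<in> ?R"
      proof (cases "v \<in> B")
        case True
        then have "B = insert v (B - {v})" "B - {v} \<in> ksubsets V k"
          using B fin by (auto simp: ksubsets_def)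
        then show ?thesis by blast
      next
        case False
        then show ?thesis using B by (auto simp: ksubsets_def)
      qed
    qed
    have "card (insert v B) = Suc (card B)" if "B \<subseteq> V" for B
      using that assms by (metis card_insert_disjoint finite_subset subsetD)
    then show "?R \<subseteq> ?L" by (auto simp: ksubsets_def)
  qed
  have "inj_on (insert v) (ksubsets V k)"
    using assms(2) by (auto simp: inj_on_def ksubsets_def)
  moreover have "insert v ` ksubsets V k \<inter> ksubsets V (Suc k) = {}"
    using assms(2) by (auto simp: ksubsets_def)
  ultimately show ?thesis
    unfolding eq using assms(1) by (simp add: sum.union_disjoint sum.reindex finite_ksubsets)
qed

text \<open>Total probability: a random \<open>k\<close>-subset of \<open>insert v V\<close>
  contains \<open>v\<close> with probability \<open>k / Suc (card V)\<close>. For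
  \<open>k = 0\<close> the truncated \<open>k - 1\<close> is harmless, because its coefficient is
  0.\<close>

lemma avg_ksubsets_insert:
  assumes "finite V" "v \<notin> V" "k \<le> Suc (card V)"
  shows "avg (ksubsets (insert v V) k) g
    = real k / real (Suc (card V)) * avg (ksubsets V (k - 1)) (\<lambda>B. g (insert v B))
      + (1 - real k / real (Suc (card V))) * avg (ksubsets V k) g"
proof (cases k)
  case 0
  then show ?thesis using assms by (simp add: ksubsets_0 avg_def)
next
  case (Suc l)
  \<comment> \<open>\<open>C1\<close> counts the sets that contain \<open>v\<close> and
    \<open>C2\<close> those that avoid it; \<open>C2 = 0\<close> occurs exactly for
    \<open>k = Suc m\<close>.\<close>
  define m C1 C2 where "m = card V" and "C1 = real (m choose l)" and "C2 = real (m choose Suc l)"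
  have C1: "C1 > 0" using assms Suc by (simp add: C1_def m_def)
  have C2: "C2 \<ge> 0" by (simp add: C2_def)
  have C: "real (Suc m choose Suc l) = C1 + C2" by (simp add: C1_def C2_def)
  have "real (Suc l) * (C1 + C2) = real (Suc m) * C1"
    unfolding C[symmetric] unfolding C1_def using arg_cong[OF Suc_times_binomial_eq[of m l], of real]
    by (simp only: of_nat_mult mult.commute)
  then have q: "real k / real (Suc m) = C1 / (C1 + C2)"
    using C1 C2 unfolding Suc by (simp add: divide_simps del: of_nat_Suc)
  have q': "1 - C1 / (C1 + C2) = C2 / (C1 + C2)"
    using C1 C2 by (simp add: field_simps)
  have "C2 / (C1 + C2) * (sum g (ksubsets V (Suc l)) / C2) = sum g (ksubsets V (Suc l)) / (C1 + C2)"
  proof (cases "C2 = 0")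
    case True
    then have "ksubsets V (Suc l) = {}"
      using assms card_ksubsets[of V "Suc l"] finite_ksubsets[of V "Suc l"]
      by (simp add: C2_def m_def binomial_eq_0)
    then show ?thesis by simp
  qed simp
  moreover have "C1 / (C1 + C2) * (X / C1) = X / (C1 + C2)" for X
    using C1 by simp
  moreover have "real (card (ksubsets (insert v V) k)) = C1 + C2"
    "real (card (ksubsets V (k - 1))) = C1" "real (card (ksubsets V k)) = C2"
    using card_ksubsets[of "insert v V" k] card_ksubsets[of V] assms Suc C
    by (simp_all add: m_def C1_def C2_def)
  moreover have "sum g (ksubsets (insert v V) k)
      = (\<Sum>B\<in>ksubsets V (k - 1). g (insert v B)) + sum g (ksubsets V k)"
    using sum_ksubsets_insert[OF assms(1,2)] Suc by simp
  ultimately show ?thesis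
    unfolding m_def[symmetric] q q' avg_def by (simp only: add_divide_distrib Suc)
qed

lemma sqrt_prod: "sqrt (prod f A) = (\<Prod>x\<in>A. sqrt (f x))"
  by (induction A rule: infinite_finite_induct) (auto simp: real_sqrt_mult)

text \<open>Induction on \<open>V\<close>, revealing the class of one vertex at a time: with the exponent 2 the
  step is exactly \<open>sum_prod_le_sqrt_prod\<close>, where \<open>q j\<close> is the probability that the vertex lies in
  class \<open>j\<close>.\<close>

lemma sum_colorings_prod_le:
  fixes \<psi> :: "'i \<Rightarrow> 'a set \<Rightarrow> real"
  assumes "finite V" "finite J" "sum b J = card V" "\<And>j B. 0 \<le> \<psi> j B"
  shows "(\<Sum>c\<in>colorings V J b. \<Prod>j\<in>J. \<psi> j {v \<in> V. c v = j})
    \<le> card (colorings V J b) * (\<Prod>j\<in>J. sqrt (avg (ksubsets V (b j)) (\<lambda>B. (\<psi> j B)\<^sup>2)))"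
  using assms
proof (induction V arbitrary: b \<psi> rule: finite_induct)
  case empty
  then have "\<forall>j\<in>J. b j = 0" by simp
  then have 1: "colorings ({} :: 'a set) J b = {\<lambda>_. undefined}" by (auto simp: colorings_def)
  show ?case using \<open>\<forall>j\<in>J. b j = 0\<close> empty.prems by (simp add: 1 ksubsets_0 avg_def)
next
  case (insert v V)
  define m where "m = real (Suc (card V))"
  define q where "q j = real (b j) / m" for j
  \<comment> \<open>\<open>x j\<close> and \<open>y j\<close> are the root mean squares of
    \<open>\<psi> j\<close> on the random class \<open>j\<close>, given that \<open>v\<close> does
    or does not lie in it.\<close>
  define x where "x j = sqrt (avg (ksubsets V (b j - 1)) (\<lambda>B. (\<psi> j (insert v B))\<^sup>2))" for j
  define y where "y j = sqrt (avg (ksubsets V (b j)) (\<lambda>B. (\<psi> j B)\<^sup>2))" for j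
  define N where "N = real (card (colorings (insert v V) J b))"
  have m: "m > 0" by (simp add: m_def)
  have sumb: "sum b J = Suc (card V)" using insert by simp
  have step: "(\<Sum>c\<in>colorings V J (b(i := b i - 1)). \<Prod>j\<in>J. \<psi> j {u \<in> insert v V. (c(v := i)) u = j})
      \<le> N * (q i * x i * (\<Prod>j\<in>J - {i}. y j))" if i: "i \<in> J" "0 < b i" for i
  proof -
    \<comment> \<open>Once \<open>v\<close> is in class \<open>i\<close>, that class is
      \<open>insert v B\<close> with \<open>B\<close> one vertex smaller. Absorbing \<open>v\<close>
      into the test function of class \<open>i\<close> brings the sum under the induction
      hypothesis.\<close>
    define b' where "b' = b(i := b i - 1)"
    define \<psi>' where "\<psi>' = \<psi>(i := \<lambda>B. \<psi> i (insert v B))"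
    have "(\<Sum>c\<in>colorings V J b'. \<Prod>j\<in>J. \<psi> j {u \<in> insert v V. (c(v := i)) u = j})
        = (\<Sum>c\<in>colorings V J b'. \<Prod>j\<in>J. \<psi>' j {u \<in> V. c u = j})"
      unfolding fibre_insert[OF insert.hyps(2)] \<psi>'_def by (intro sum.cong prod.cong) auto
    also have "\<dots> \<le> card (colorings V J b') * (\<Prod>j\<in>J. sqrt (avg (ksubsets V (b' j)) (\<lambda>B. (\<psi>' j B)\<^sup>2)))"
      using sum_fun_upd_pred[of J i b] i insert.prems sumb
      by (intro insert.IH) (auto simp: b'_def \<psi>'_def)
    also have "(\<Prod>j\<in>J. sqrt (avg (ksubsets V (b' j)) (\<lambda>B. (\<psi>' j B)\<^sup>2))) = x i * (\<Prod>j\<in>J - {i}. y j)"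
    proof -
      have "(\<Prod>j\<in>J - {i}. sqrt (avg (ksubsets V (b' j)) (\<lambda>B. (\<psi>' j B)\<^sup>2))) = (\<Prod>j\<in>J - {i}. y j)"
        by (rule prod.cong) (auto simp: y_def b'_def \<psi>'_def)
      then show ?thesis
        using i \<open>finite J\<close> by (simp add: prod.remove[of J i] x_def b'_def \<psi>'_def)
    qed
    also have "real (card (colorings V J b')) = N * q i"
    proof -
      have "real (card (colorings V J b')) * m = real (b i) * N"
        using card_colorings_pred[OF insert.hyps(1,2) \<open>finite J\<close> sumb i]
        unfolding b'_def m_def N_def by (metis of_nat_mult)
      then show ?thesis using m by (simp add: q_def field_simps)
    qed
    finally show ?thesis unfolding b'_def by (simp only: mult.assoc)
  qed
  have "(\<Sum>c\<in>colorings (insert v V) J b. \<Prod>j\<in>J. \<psi> j {u \<in> insert v V. c u = j})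
      \<le> (\<Sum>i\<in>{i \<in> J. 0 < b i}. N * (q i * x i * (\<Prod>j\<in>J - {i}. y j)))"
    unfolding sum_colorings_insert[OF insert.hyps(1,2) \<open>finite J\<close>]
    by (rule sum_mono) (use step in auto)
  \<comment> \<open>Labels with \<open>b i = 0\<close> have \<open>q i = 0\<close> and may be added
    to the sum.\<close>
  also have "\<dots> = N * (\<Sum>i\<in>J. q i * x i * (\<Prod>j\<in>J - {i}. y j))"
    unfolding sum_distrib_left
    by (rule sum.mono_neutral_left) (use \<open>finite J\<close> in \<open>auto simp: q_def\<close>)
  also have "\<dots> \<le> N * sqrt (\<Prod>j\<in>J. q j * (x j)\<^sup>2 + (1 - q j) * (y j)\<^sup>2)"
  proof (intro mult_left_mono sum_prod_le_sqrt_prod)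
    have "sum q J = real (sum b J) / m" unfolding q_def by (simp add: sum_divide_distrib)
    then show "sum q J = 1" using sumb m by (simp add: m_def)
  qed (use \<open>finite J\<close> m in \<open>auto simp: q_def N_def\<close>)
  also have "(\<Prod>j\<in>J. q j * (x j)\<^sup>2 + (1 - q j) * (y j)\<^sup>2)
      = (\<Prod>j\<in>J. avg (ksubsets (insert v V) (b j)) (\<lambda>B. (\<psi> j B)\<^sup>2))"
  proof (rule prod.cong)
    fix j assume "j \<in> J"
    then have "b j \<le> Suc (card V)" using sumb \<open>finite J\<close> by (metis member_le_sum zero_le)
    then show "q j * (x j)\<^sup>2 + (1 - q j) * (y j)\<^sup>2
        = avg (ksubsets (insert v V) (b j)) (\<lambda>B. (\<psi> j B)\<^sup>2)"
      unfolding avg_ksubsets_insert[OF insert.hyps(1,2) \<open>b j \<le> Suc (card V)\<close>]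
      by (simp add: x_def y_def q_def m_def avg_nonneg)
  qed simp
  finally show ?case by (simp add: sqrt_prod N_def)
qed

section \<open>Exponential moments and Chernoff's bound\<close>

text \<open>The Taylor polynomial 1 + x + x^2/2 bounds \<open>exp x\<close> from below, and its
  product with the right side is 1 + x^4/4.\<close>

lemma exp_minus_le_quadratic:
  fixes x :: real
  assumes "0 \<le> x"
  shows "exp (- x) \<le> 1 - x + x\<^sup>2 / 2"
proof -
  have "1 \<le> (1 + x + x\<^sup>2 / 2) * (1 - x + x\<^sup>2 / 2)"
  proof -
    have "(1 + x + x\<^sup>2 / 2) * (1 - x + x\<^sup>2 / 2) = 1 + (x\<^sup>2)\<^sup>2 / 4"
      by (simp add: algebra_simps power2_eq_square)
    then show ?thesis by simp
  qed
  also have "\<dots> \<le> exp x * (1 - x + x\<^sup>2 / 2)"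
  proof (rule mult_right_mono[OF exp_lower_Taylor_quadratic[OF assms]])
    have "1 - x + x\<^sup>2 / 2 = ((1 - x)\<^sup>2 + 1) / 2"
      by (simp add: power2_eq_square field_simps)
    also have "\<dots> \<ge> 0" by simp
    finally show "0 \<le> 1 - x + x\<^sup>2 / 2" by simp
  qed
  finally show ?thesis by (simp add: exp_minus field_simps)
qed

text \<open>Chernoff's bound, with \<open>sum_colorings_prod_le\<close> replacing independence; averaging squares
  only doubles \<open>s\<close>.\<close>

lemma sum_colorings_exp_le:
  fixes s p :: real
  assumes "finite V" "finite J" "sum b J = card V" "J0 \<subseteq> J" "\<And>j. j \<in> J0 \<Longrightarrow> b j = r"
    and "r \<le> card V" "0 \<le> s" "p = real (card (ksubsets V r \<inter> F)) / real (card V choose r)"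
  shows "(\<Sum>c\<in>colorings V J b. exp (- s * real (card {j \<in> J0. {v \<in> V. c v = j} \<in> F})))
    \<le> card (colorings V J b) * exp (real (card J0) * (p * s\<^sup>2 - p * s))"
proof -
  define \<psi> where "\<psi> j B = (if j \<in> J0 \<and> B \<in> F then exp (- s) else 1)" for j B
  have c: "card (ksubsets V r) = card V choose r" "0 < card V choose r"
    using assms by (auto simp: card_ksubsets)
  have p0: "0 \<le> p" using assms by simp
  have L: "exp (- s * real (card {j \<in> J0. {v \<in> V. c v = j} \<in> F})) = (\<Prod>j\<in>J. \<psi> j {v \<in> V. c v = j})" for c
  proof -
    have "(\<Prod>j\<in>J. \<psi> j {v \<in> V. c v = j}) = (\<Prod>j\<in>{j \<in> J0. {v \<in> V. c v = j} \<in> F}. exp (- s))"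
      using assms by (intro prod.mono_neutral_cong_right) (auto simp: \<psi>_def)
    then show ?thesis by (simp add: exp_of_nat_mult[symmetric] mult.commute)
  qed
  have avg_J0: "avg (ksubsets V r) (\<lambda>B. (\<psi> j B)\<^sup>2) \<le> exp (2 * (p * s\<^sup>2 - p * s))" if "j \<in> J0" for j
  proof -
    have "(\<Sum>B\<in>ksubsets V r. (\<psi> j B)\<^sup>2) = (\<Sum>B\<in>ksubsets V r. 1 - (if B \<in> F then 1 - exp (- 2 * s) else 0))"
      using that by (intro sum.cong) (auto simp: \<psi>_def exp_double[symmetric] power2_eq_square mult_exp_exp)
    also have "\<dots> = real (card V choose r) - real (card (ksubsets V r \<inter> F)) * (1 - exp (- 2 * s))"
      using assms c by (simp add: sum_subtractf sum.If_cases finite_ksubsets Int_def)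
    finally have "avg (ksubsets V r) (\<lambda>B. (\<psi> j B)\<^sup>2) = 1 - p * (1 - exp (- 2 * s))"
      unfolding avg_def using c assms by (simp add: field_simps)
    \<comment> \<open>The quadratic bound is used at \<open>2 * s\<close>. The factor 2 in the
      resulting exponent cancels against the square root taken below.\<close>
    also have "1 - p * (1 - exp (- 2 * s)) \<le> 1 - p * (2 * s - 2 * s\<^sup>2)"
    proof -
      have "2 * s - (2 * s)\<^sup>2 / 2 \<le> 1 - exp (- 2 * s)"
        using exp_minus_le_quadratic[of "2 * s"] assms by simp
      then show ?thesis using p0 by (intro diff_left_mono mult_left_mono) (auto simp: power2_eq_square)
    qed
    also have "\<dots> = 1 + 2 * (p * s\<^sup>2 - p * s)" by (simp add: algebra_simps)
    also have "\<dots> \<le> exp (2 * (p * s\<^sup>2 - p * s))" by (rule exp_ge_add_one_self)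
    finally show ?thesis .
  qed
  \<comment> \<open>Outside \<open>J0\<close> the test function is constantly 1; stating
    \<open>\<le>\<close> avoids a case distinction on whether the family is empty.\<close>
  have avg_1: "avg (ksubsets V (b j)) (\<lambda>B. (\<psi> j B)\<^sup>2) \<le> 1" if "j \<in> J" "j \<notin> J0" for j
    using that by (simp add: avg_def \<psi>_def)
  have "(\<Prod>j\<in>J. sqrt (avg (ksubsets V (b j)) (\<lambda>B. (\<psi> j B)\<^sup>2)))
      \<le> (\<Prod>j\<in>J. if j \<in> J0 then exp (p * s\<^sup>2 - p * s) else 1)"
  proof (intro prod_mono conjI)
    fix j assume "j \<in> J"
    have "sqrt (avg (ksubsets V (b j)) (\<lambda>B. (\<psi> j B)\<^sup>2)) \<le> exp (p * s\<^sup>2 - p * s)" if "j \<in> J0"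
      using avg_J0[OF that] assms(5)[OF that] by (intro real_le_lsqrt) (auto simp: exp_double[symmetric] algebra_simps)
    then show "sqrt (avg (ksubsets V (b j)) (\<lambda>B. (\<psi> j B)\<^sup>2)) \<le> (if j \<in> J0 then exp (p * s\<^sup>2 - p * s) else 1)"
      using avg_1[OF \<open>j \<in> J\<close>] by auto
  qed (simp add: avg_nonneg)
  also have "\<dots> = exp (real (card J0) * (p * s\<^sup>2 - p * s))"
    using assms by (simp add: prod.If_cases exp_of_nat_mult Int_absorb1)
  finally have "(\<Prod>j\<in>J. sqrt (avg (ksubsets V (b j)) (\<lambda>B. (\<psi> j B)\<^sup>2))) \<le> \<dots>" .
  then have "card (colorings V J b) * (\<Prod>j\<in>J. sqrt (avg (ksubsets V (b j)) (\<lambda>B. (\<psi> j B)\<^sup>2)))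
      \<le> card (colorings V J b) * exp (real (card J0) * (p * s\<^sup>2 - p * s))"
    by (intro mult_left_mono) auto
  moreover have "(\<Sum>c\<in>colorings V J b. \<Prod>j\<in>J. \<psi> j {v \<in> V. c v = j})
      \<le> card (colorings V J b) * (\<Prod>j\<in>J. sqrt (avg (ksubsets V (b j)) (\<lambda>B. (\<psi> j B)\<^sup>2)))"
    by (rule sum_colorings_prod_le) (use assms in \<open>auto simp: \<psi>_def\<close>)
  ultimately show ?thesis unfolding L by linarith
qed

text \<open>Markov's inequality for exp(-s X), where X counts the classes from \<open>J0\<close>
  that belong to \<open>F\<close>. With t the size of \<open>J0\<close>, the excess
  \<open>4 * s\<close> in the density contributes -4 s^2 t to the exponent and the quadratic error
  costs at most s^2 t, which leaves -3 s^2 t. The term 1/2 is each side's share of the 1 in the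
  degree sum t + 1 of \<open>moon_moser\<close>.\<close>

lemma card_colorings_tail:
  fixes s \<beta> :: real
  assumes "finite V" "finite J" "sum b J = card V" "J0 \<subseteq> J" "\<And>j. j \<in> J0 \<Longrightarrow> b j = r"
    and "r \<le> card V" "0 \<le> s"
    and dense: "(\<beta> + 4 * s) * real (card V choose r) \<le> real (card (ksubsets V r \<inter> F))"
  shows "real (card {c \<in> colorings V J b.
      real (card {j \<in> J0. {v \<in> V. c v = j} \<in> F}) < \<beta> * real (card J0) + 1 / 2})
    \<le> real (card (colorings V J b)) * exp (s / 2 - 3 * s\<^sup>2 * real (card J0))"
proof -
  define t where "t = real (card J0)"
  define X where "X c = real (card {j \<in> J0. {v \<in> V. c v = j} \<in> F})" for c
  define N where "N = real (card (colorings V J b))"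
  define bad where "bad = {c \<in> colorings V J b. X c < \<beta> * t + 1 / 2}"
  define p where "p = real (card (ksubsets V r \<inter> F)) / real (card V choose r)"
  have C: "real (card V choose r) > 0" using assms by simp
  have p1: "p \<le> 1"
    using card_mono[of "ksubsets V r" "ksubsets V r \<inter> F"] C assms
    by (simp add: p_def finite_ksubsets card_ksubsets)
  have p2: "\<beta> + 4 * s \<le> p" using dense C by (simp add: p_def pos_le_divide_eq)
  have fin: "finite (colorings V J b)" using assms by (simp add: finite_colorings)
  have "real (card bad) * exp (- s * (\<beta> * t + 1 / 2)) = (\<Sum>c\<in>bad. exp (- s * (\<beta> * t + 1 / 2)))"
    by simp
  also have "\<dots> \<le> (\<Sum>c\<in>bad. exp (- s * X c))"
    using \<open>0 \<le> s\<close> by (intro sum_mono) (auto simp: bad_def intro!: mult_left_mono)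
  also have "\<dots> \<le> (\<Sum>c\<in>colorings V J b. exp (- s * X c))"
    using fin by (intro sum_mono2) (auto simp: bad_def)
  also have "\<dots> \<le> N * exp (t * (p * s\<^sup>2 - p * s))"
    unfolding X_def N_def t_def
    by (rule sum_colorings_exp_le[OF assms(1-7) p_def])
  also have "\<dots> \<le> N * exp (t * (s\<^sup>2 - (\<beta> + 4 * s) * s))"
  proof -
    \<comment> \<open>The density enters in opposite directions: \<open>p \<le> 1\<close> bounds the
      quadratic term, \<open>\<beta> + 4 * s \<le> p\<close> the linear one.\<close>
    have "p * s\<^sup>2 \<le> s\<^sup>2" using mult_right_mono[OF p1, of "s\<^sup>2"] by simp
    moreover have "(\<beta> + 4 * s) * s \<le> p * s" using p2 \<open>0 \<le> s\<close> by (rule mult_right_mono)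
    ultimately have "t * (p * s\<^sup>2 - p * s) \<le> t * (s\<^sup>2 - (\<beta> + 4 * s) * s)"
      by (intro mult_left_mono) (auto simp: t_def)
    then show ?thesis by (auto simp: N_def intro!: mult_left_mono)
  qed
  finally have "real (card bad) * exp (- s * (\<beta> * t + 1 / 2)) * exp (s * (\<beta> * t + 1 / 2))
      \<le> N * exp (t * (s\<^sup>2 - (\<beta> + 4 * s) * s)) * exp (s * (\<beta> * t + 1 / 2))"
    by (rule mult_right_mono) simp
  then have "real (card bad) \<le> N * exp (t * (s\<^sup>2 - (\<beta> + 4 * s) * s) + s * (\<beta> * t + 1 / 2))"
    by (simp add: mult.assoc exp_add[symmetric])
  also have "t * (s\<^sup>2 - (\<beta> + 4 * s) * s) + s * (\<beta> * t + 1 / 2) = s / 2 - 3 * s\<^sup>2 * t"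
    by (simp add: power2_eq_square algebra_simps)
  finally show ?thesis unfolding bad_def X_def N_def t_def .
qed

section \<open>Conditioning on one whole class\<close>

text \<open>First choose class \<open>i\<close> as a set \<open>S\<close>, then partition the rest:
  given \<open>S\<close>, the other classes form a uniformly random partition of
  \<open>V - S\<close>, to which \<open>card_colorings_tail\<close> applies.\<close>

lemma colorings_fibre:
  assumes "finite V" "i \<in> J"
  shows "bij_betw (\<lambda>(S, c) v. if v \<in> S then i else c v)
    (SIGMA S:ksubsets V (b i). colorings (V - S) (J - {i}) b) (colorings V J b)"
proof (rule bij_betw_byWitness[where f' = "\<lambda>c. ({v \<in> V. c v = i}, restrict c (V - {v \<in> V. c v = i}))"])
  have fib: "{v \<in> V. (if v \<in> S then i else c v) = j} = (if j = i then S else {v \<in> V - S. c v = j})"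
    if "S \<subseteq> V" "c \<in> V - S \<rightarrow>\<^sub>E J - {i}" for S c j
    using that by (auto simp: PiE_iff)
  show "\<forall>p\<in>SIGMA S:ksubsets V (b i). colorings (V - S) (J - {i}) b.
    (\<lambda>c. ({v \<in> V. c v = i}, restrict c (V - {v \<in> V. c v = i})))
      ((\<lambda>(S, c) v. if v \<in> S then i else c v) p) = p"
  proof
    fix p assume "p \<in> (SIGMA S:ksubsets V (b i). colorings (V - S) (J - {i}) b)"
    then obtain S c where p: "p = (S, c)" and S: "S \<in> ksubsets V (b i)"
      and c: "c \<in> colorings (V - S) (J - {i}) b"
      by blast
    then have SV: "S \<subseteq> V" and cP: "c \<in> V - S \<rightarrow>\<^sub>E J - {i}" by (auto simp: ksubsets_def colorings_def)
    have "restrict (\<lambda>v. if v \<in> S then i else c v) (V - S) = c"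
      using cP by (auto simp: restrict_def PiE_iff extensional_def fun_eq_iff)
    then show "(\<lambda>c. ({v \<in> V. c v = i}, restrict c (V - {v \<in> V. c v = i})))
        ((\<lambda>(S, c) v. if v \<in> S then i else c v) p) = p"
      unfolding p prod.case fib[OF SV cP] by simp
  qed
  show "\<forall>c\<in>colorings V J b. (\<lambda>(S, c) v. if v \<in> S then i else c v)
      ({v \<in> V. c v = i}, restrict c (V - {v \<in> V. c v = i})) = c"
    by (auto simp: colorings_def PiE_iff extensional_def fun_eq_iff)
  show "(\<lambda>(S, c) v. if v \<in> S then i else c v) `
      (SIGMA S:ksubsets V (b i). colorings (V - S) (J - {i}) b) \<subseteq> colorings V J b"
  proof clarify
    fix S c assume S: "S \<in> ksubsets V (b i)" and c: "c \<in> colorings (V - S) (J - {i}) b"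
    then have SV: "S \<subseteq> V" and cP: "c \<in> V - S \<rightarrow>\<^sub>E J - {i}" by (auto simp: ksubsets_def colorings_def)
    have "(\<lambda>v. if v \<in> S then i else c v) \<in> V \<rightarrow>\<^sub>E J"
      using cP SV assms by (auto simp: PiE_iff extensional_def)
    then show "(\<lambda>v. if v \<in> S then i else c v) \<in> colorings V J b"
      using S c unfolding colorings_def mem_Collect_eq fib[OF SV cP] by (auto simp: ksubsets_def)
  qed
  show "(\<lambda>c. ({v \<in> V. c v = i}, restrict c (V - {v \<in> V. c v = i}))) ` colorings V J b
      \<subseteq> (SIGMA S:ksubsets V (b i). colorings (V - S) (J - {i}) b)"
  proof clarify
    fix c assume c: "c \<in> colorings V J b"
    let ?S = "{v \<in> V. c v = i}"
    have "?S \<in> ksubsets V (b i)" using c assms by (auto simp: ksubsets_def colorings_def)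
    moreover have "{v \<in> V - ?S. restrict c (V - ?S) v = j} = {v \<in> V. c v = j}" if "j \<in> J - {i}" for j
      using that by auto
    then have "restrict c (V - ?S) \<in> colorings (V - ?S) (J - {i}) b"
      using c unfolding colorings_def mem_Collect_eq by (auto simp: PiE_iff)
    ultimately show "?S \<in> ksubsets V (b i) \<and> restrict c (V - ?S) \<in> colorings (V - ?S) (J - {i}) b"
      by blast
  qed
qed

lemma card_colorings_fibre:
  assumes "finite V" "finite J" "i \<in> J"
  shows "card {c \<in> colorings V J b. P c}
    = (\<Sum>S\<in>ksubsets V (b i). card {c \<in> colorings (V - S) (J - {i}) b. P (\<lambda>v. if v \<in> S then i else c v)})"
proof -
  have *: "card {c \<in> A. Q c} = (\<Sum>c\<in>A. if Q c then 1 else 0)" if "finite A" for A :: "('a \<Rightarrow> 'b) set" and Q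
    using that by (simp add: sum.If_cases Int_def)
  have "(\<Sum>c\<in>colorings V J b. if P c then 1 else 0 :: nat)
      = (\<Sum>(S, c)\<in>(SIGMA S:ksubsets V (b i). colorings (V - S) (J - {i}) b).
          if P (\<lambda>v. if v \<in> S then i else c v) then 1 else 0)"
    unfolding sum.reindex_bij_betw[OF colorings_fibre[OF assms(1,3)], symmetric]
    by (simp add: case_prod_beta)
  also have "\<dots> = (\<Sum>S\<in>ksubsets V (b i). \<Sum>c\<in>colorings (V - S) (J - {i}) b.
      if P (\<lambda>v. if v \<in> S then i else c v) then 1 else 0)"
    using assms by (subst sum.Sigma) (auto simp: finite_ksubsets finite_colorings)
  finally show ?thesis using assms by (simp add: * finite_colorings)
qed

text \<open>Given that class \<open>i\<close> is \<open>S\<close>, the count concerns only the other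
  classes and the link of \<open>S\<close>, so \<open>card_colorings_tail\<close> applies on
  \<open>V - S\<close>. The exponential factor is the same for every \<open>S\<close> and survives
  summation.\<close>

lemma card_colorings_link_tail:
  fixes s \<beta> :: real
  assumes "finite V" "finite J" "sum b J = card V" "i \<in> J" "J0 \<subseteq> J - {i}"
    and "\<And>j. j \<in> J0 \<Longrightarrow> b j = r" "b i + r \<le> card V" "0 \<le> s"
    and dense: "\<And>S. S \<in> ksubsets V (b i) \<Longrightarrow>
      (\<beta> + 4 * s) * real ((card V - b i) choose r) \<le> real (card (ksubsets (V - S) r \<inter> {B. S \<union> B \<in> H}))"
  shows "real (card {c \<in> colorings V J b.
      real (card {j \<in> J0. {v \<in> V. c v = i} \<union> {v \<in> V. c v = j} \<in> H}) < \<beta> * real (card J0) + 1 / 2})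
    \<le> real (card (colorings V J b)) * exp (s / 2 - 3 * s\<^sup>2 * real (card J0))"
proof -
  let ?e = "exp (s / 2 - 3 * s\<^sup>2 * real (card J0))"
  let ?P = "\<lambda>c. real (card {j \<in> J0. {v \<in> V. c v = i} \<union> {v \<in> V. c v = j} \<in> H})
      < \<beta> * real (card J0) + 1 / 2"
  have "real (card {c \<in> colorings (V - S) (J - {i}) b. ?P (\<lambda>v. if v \<in> S then i else c v)})
      \<le> real (card (colorings (V - S) (J - {i}) b)) * ?e" if S: "S \<in> ksubsets V (b i)" for S
  proof -
    have SV: "S \<subseteq> V" "card S = b i" using S by (auto simp: ksubsets_def)
    then have cVS: "card (V - S) = card V - b i"
      using assms(1) by (simp add: card_Diff_subset finite_subset)
    \<comment> \<open>The label \<open>i\<close> does not occur on \<open>V - S\<close>, so class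
      \<open>i\<close> of the glued colouring is \<open>S\<close> and the classes in
      \<open>J0\<close> are those of \<open>c\<close>.\<close>
    have "{j \<in> J0. {v \<in> V. (if v \<in> S then i else c v) = i} \<union> {v \<in> V. (if v \<in> S then i else c v) = j} \<in> H}
        = {j \<in> J0. {v \<in> V - S. c v = j} \<in> {B. S \<union> B \<in> H}}" if c: "c \<in> colorings (V - S) (J - {i}) b" for c
    proof -
      have cJ: "c v \<noteq> i" if "v \<in> V - S" for v using c that by (auto simp: colorings_def PiE_iff)
      have "{v \<in> V. (if v \<in> S then i else c v) = i} = S" using SV cJ by auto
      moreover have "{v \<in> V. (if v \<in> S then i else c v) = j} = {v \<in> V - S. c v = j}" if "j \<in> J0" for j
        using that assms(5) by auto
      ultimately show ?thesis
        by (intro Collect_cong conj_cong) (simp_all only: mem_Collect_eq)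
    qed
    then have "{c \<in> colorings (V - S) (J - {i}) b. ?P (\<lambda>v. if v \<in> S then i else c v)}
      = {c \<in> colorings (V - S) (J - {i}) b. real (card {j \<in> J0. {v \<in> V - S. c v = j} \<in> {B. S \<union> B \<in> H}})
          < \<beta> * real (card J0) + 1 / 2}"
      by (intro Collect_cong) (metis (no_types, lifting))
    moreover have "real (card {c \<in> colorings (V - S) (J - {i}) b.
        real (card {j \<in> J0. {v \<in> V - S. c v = j} \<in> {B. S \<union> B \<in> H}}) < \<beta> * real (card J0) + 1 / 2})
      \<le> real (card (colorings (V - S) (J - {i}) b)) * ?e"
    proof (rule card_colorings_tail)
      show "sum b (J - {i}) = card (V - S)"
        using assms cVS by (simp add: sum.remove[of J i])
    qed (use assms cVS dense[OF S] in auto)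
    ultimately show ?thesis by simp
  qed
  then have "real (card {c \<in> colorings V J b. ?P c})
      \<le> (\<Sum>S\<in>ksubsets V (b i). real (card (colorings (V - S) (J - {i}) b)) * ?e)"
    unfolding card_colorings_fibre[OF assms(1,2,4)] of_nat_sum by (rule sum_mono)
  \<comment> \<open>Counting with the predicate that is always true recovers the number of all
    colourings.\<close>
  also have "\<dots> = real (card (colorings V J b)) * ?e"
    using card_colorings_fibre[OF assms(1,2,4), of b "\<lambda>_. True"] by (simp add: sum_distrib_right)
  finally show ?thesis .
qed

text \<open>Adding and removing \<open>S\<close> are inverse to each other. This turns degree bounds
  into the hypothesis \<open>dense\<close> of \<open>card_colorings_link_tail\<close>, whose ambient
  set is \<open>V - S\<close>.\<close>

lemma hdeg_eq_card_link:
  assumes "finite V" "H \<subseteq> ksubsets V (d + r)" "S \<in> ksubsets V d"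
  shows "hdeg H S = card (ksubsets (V - S) r \<inter> {B. S \<union> B \<in> H})"
proof -
  have fS: "finite S" "S \<subseteq> V" "card S = d" using assms by (auto simp: ksubsets_def intro: finite_subset)
  have "bij_betw (\<lambda>B. S \<union> B) (ksubsets (V - S) r \<inter> {B. S \<union> B \<in> H}) {e \<in> H. S \<subseteq> e}"
  proof (rule bij_betw_byWitness[where f' = "\<lambda>e. e - S"])
    show "(\<lambda>e. e - S) ` {e \<in> H. S \<subseteq> e} \<subseteq> ksubsets (V - S) r \<inter> {B. S \<union> B \<in> H}"
    proof clarify
      fix e assume e: "e \<in> H" "S \<subseteq> e"
      then have "e \<subseteq> V" "card e = d + r" using assms(2) by (auto simp: ksubsets_def)
      then show "e - S \<in> ksubsets (V - S) r \<inter> {B. S \<union> B \<in> H}"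
        using e fS by (auto simp: ksubsets_def card_Diff_subset Un_absorb1)
    qed
  qed (auto simp: ksubsets_def)
  then show ?thesis unfolding hdeg_def by (simp add: bij_betw_same_card)
qed

lemma min_deg_le_hdeg:
  assumes "finite V" "S \<in> ksubsets V d"
  shows "min_deg V H d \<le> hdeg H S"
  unfolding min_deg_def using assms by (intro Min_le) (auto simp: finite_ksubsets)

subsection \<open>Hamilton cycles in bipartite graphs\<close>

text \<open>The cycle runs \<open>\<sigma> 0\<close>, \<open>\<tau> 0\<close>,
  \<open>\<sigma> 1\<close>, \<open>\<tau> 1\<close> and so on, which is the cyclic pattern of
  \<open>has_hamilton_ab_cycle\<close>. For \<open>t = 1\<close> it degenerates to a single
  edge.\<close>

definition bipartite_hamiltonian :: "nat \<Rightarrow> 'x set \<Rightarrow> 'y set \<Rightarrow> ('x \<times> 'y) set \<Rightarrow> bool" where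
  "bipartite_hamiltonian t X Y E \<longleftrightarrow> (\<exists>\<sigma> \<tau>. bij_betw \<sigma> {..<t} X \<and> bij_betw \<tau> {..<t} Y \<and>
     (\<forall>i<t. (\<sigma> i, \<tau> i) \<in> E \<and> (\<sigma> ((i + 1) mod t), \<tau> i) \<in> E))"

lemma bij_betw_lessThan_self:
  fixes f :: "nat \<Rightarrow> nat"
  assumes "inj_on f {..<t}" "\<And>i. i < t \<Longrightarrow> f i < t"
  shows "bij_betw f {..<t} {..<t}"
  using endo_inj_surj[OF finite_lessThan _ assms(1)] assms by (simp add: bij_betw_def image_subset_iff)

text \<open>The bound \<open>k \<le> t\<close> instead of \<open>k < t\<close> admits the shift
  \<open>Suc i\<close> for every \<open>i < t\<close>.\<close>

lemma bij_betw_rotate: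
  fixes k t :: nat
  assumes "k \<le> t"
  shows "bij_betw (\<lambda>j. (k + j) mod t) {..<t} {..<t}"
proof (rule bij_betw_lessThan_self)
  have "(k + j) mod t = (if k + j < t then k + j else k + j - t)" if "j < t" for j
    using that assms by (auto simp: mod_if)
  then show "inj_on (\<lambda>j. (k + j) mod t) {..<t}"
    by (auto simp: inj_on_def split: if_splits)
qed (use assms in auto)

lemma bij_betw_reverse: "bij_betw (\<lambda>j. t - 1 - j) {..<t} {..<t :: nat}"
  by (rule bij_betw_lessThan_self) (auto simp: inj_on_def)

text \<open>Rotating, and if necessary reversing, a Hamilton cycle through the edge \<open>(x, y)\<close> turns it
  into a Hamilton path from \<open>x\<close> to \<open>y\<close>.\<close>

lemma hamiltonian_path_of_insert:
  assumes "bipartite_hamiltonian t X Y (insert (x, y) E)" "2 \<le> t" "\<not> bipartite_hamiltonian t X Y E"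
  shows "\<exists>\<sigma> \<tau>. bij_betw \<sigma> {..<t} X \<and> bij_betw \<tau> {..<t} Y \<and> \<sigma> 0 = x \<and> \<tau> (t - 1) = y \<and>
    (\<forall>i<t. (\<sigma> i, \<tau> i) \<in> E) \<and> (\<forall>i. Suc i < t \<longrightarrow> (\<sigma> (Suc i), \<tau> i) \<in> E)"
proof -
  obtain \<sigma> \<tau> where \<sigma>: "bij_betw \<sigma> {..<t} X" and \<tau>: "bij_betw \<tau> {..<t} Y"
    and e: "\<forall>i<t. (\<sigma> i, \<tau> i) \<in> insert (x, y) E \<and> (\<sigma> ((i + 1) mod t), \<tau> i) \<in> insert (x, y) E"
    using assms(1) unfolding bipartite_hamiltonian_def by (elim exE conjE)
  have e1: "(\<sigma> i, \<tau> i) \<in> insert (x, y) E" and e2: "(\<sigma> (Suc i mod t), \<tau> i) \<in> insert (x, y) E"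
    if "i < t" for i
    using e that by simp_all
  \<comment> \<open>With \<open>x\<close> first and \<open>y\<close> last, \<open>x\<close> occurs
    only at index 0 and \<open>y\<close> only at \<open>t - 1\<close>, which differ because
    \<open>2 \<le> t\<close>. So the inserted edge is not on the path, and all path edges come from
    \<open>E\<close>.\<close>
  have main: ?thesis
    if \<sigma>': "bij_betw \<sigma>' {..<t} X" and \<tau>': "bij_betw \<tau>' {..<t} Y"
      and x: "\<sigma>' 0 = x" and y: "\<tau>' (t - 1) = y"
      and 1: "\<And>i. i < t \<Longrightarrow> (\<sigma>' i, \<tau>' i) \<in> insert (x, y) E"
      and 2: "\<And>i. Suc i < t \<Longrightarrow> (\<sigma>' (Suc i), \<tau>' i) \<in> insert (x, y) E"
    for \<sigma>' \<tau>'
  proof -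
    have \<sigma>x: "i = 0" if "\<sigma>' i = x" "i < t" for i
      using inj_onD[OF bij_betw_imp_inj_on[OF \<sigma>'], of i 0] x that by simp
    have \<tau>y: "i = t - 1" if "\<tau>' i = y" "i < t" for i
      using inj_onD[OF bij_betw_imp_inj_on[OF \<tau>'], of i "t - 1"] y that by simp
    have "(\<sigma>' i, \<tau>' i) \<in> E" if "i < t" for i
    proof -
      have "\<not> (\<sigma>' i = x \<and> \<tau>' i = y)"
        using \<sigma>x[OF _ that] \<tau>y[OF _ that] assms(2) by linarith
      then show ?thesis using 1[OF that] by blast
    qed
    moreover have "(\<sigma>' (Suc i), \<tau>' i) \<in> E" if "Suc i < t" for i
      using 2[OF that] \<sigma>x[OF _ that] by blast
    ultimately show ?thesis using \<sigma>' \<tau>' x y by blast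
  qed
  have "\<exists>i<t. (\<sigma> i, \<tau> i) = (x, y) \<or> (\<sigma> (Suc i mod t), \<tau> i) = (x, y)"
  proof (rule ccontr)
    assume "\<not> ?thesis"
    then have "\<forall>i<t. (\<sigma> i, \<tau> i) \<in> E \<and> (\<sigma> ((i + 1) mod t), \<tau> i) \<in> E"
      using e1 e2 unfolding Suc_eq_plus1 by blast
    then have "bipartite_hamiltonian t X Y E"
      unfolding bipartite_hamiltonian_def using \<sigma> \<tau> by blast
    then show False using assms(3) by blast
  qed
  then obtain i where i: "i < t" and "(\<sigma> i, \<tau> i) = (x, y) \<or> (\<sigma> (Suc i mod t), \<tau> i) = (x, y)"
    by blast
  then consider "\<sigma> i = x" "\<tau> i = y" | "\<sigma> (Suc i mod t) = x" "\<tau> i = y" by auto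
  then show ?thesis
  proof cases
    case 1
    \<comment> \<open>The cycle runs from \<open>x\<close> directly to \<open>y\<close>, so it is
      traversed backwards from \<open>x\<close>: modulo \<open>t\<close> the indices are
      \<open>i - j\<close> for \<open>\<sigma>\<close> and \<open>i - 1 - j\<close> for
      \<open>\<tau>\<close>, shifted by \<open>t\<close> to avoid truncated subtraction.\<close>
    define \<sigma>' where "\<sigma>' j = \<sigma> ((Suc i + (t - 1 - j)) mod t)" for j
    define \<tau>' where "\<tau>' j = \<tau> ((i + (t - 1 - j)) mod t)" for j
    show ?thesis
    proof (rule main[of \<sigma>' \<tau>'])
      have "\<sigma>' = \<sigma> \<circ> ((\<lambda>j. (Suc i + j) mod t) \<circ> (\<lambda>j. t - 1 - j))" by (auto simp: \<sigma>'_def)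
      then show "bij_betw \<sigma>' {..<t} X"
        using bij_betw_trans[OF bij_betw_trans[OF bij_betw_reverse bij_betw_rotate[of "Suc i" t]] \<sigma>] i
        by simp
      have "\<tau>' = \<tau> \<circ> ((\<lambda>j. (i + j) mod t) \<circ> (\<lambda>j. t - 1 - j))" by (auto simp: \<tau>'_def)
      then show "bij_betw \<tau>' {..<t} Y"
        using bij_betw_trans[OF bij_betw_trans[OF bij_betw_reverse bij_betw_rotate[of i t]] \<tau>] i
        by simp
      have "Suc i + (t - 1 - 0) = i + t" using assms(2) by simp
      then show "\<sigma>' 0 = x" using 1 i by (simp add: \<sigma>'_def)
      show "\<tau>' (t - 1) = y" using 1 i by (simp add: \<tau>'_def)
      show "(\<sigma>' j, \<tau>' j) \<in> insert (x, y) E" if "j < t" for j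
        using e2[of "(i + (t - 1 - j)) mod t"] assms(2) by (simp add: \<sigma>'_def \<tau>'_def mod_Suc_eq)
      show "(\<sigma>' (Suc j), \<tau>' j) \<in> insert (x, y) E" if "Suc j < t" for j
      proof -
        have "Suc i + (t - 1 - Suc j) = i + (t - 1 - j)" using that by simp
        then show ?thesis
          using e1[of "(i + (t - 1 - j)) mod t"] assms(2) by (simp only: \<sigma>'_def \<tau>'_def) simp
      qed
    qed
  next
    case 2
    \<comment> \<open>Here the cycle runs from \<open>y\<close> to \<open>x\<close>, so it suffices
      to start it just after that edge.\<close>
    define \<sigma>' where "\<sigma>' j = \<sigma> ((Suc i + j) mod t)" for j
    define \<tau>' where "\<tau>' j = \<tau> ((Suc i + j) mod t)" for j
    show ?thesis
    proof (rule main[of \<sigma>' \<tau>'])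
      show "bij_betw \<sigma>' {..<t} X" "bij_betw \<tau>' {..<t} Y"
        using bij_betw_trans[OF bij_betw_rotate[of "Suc i" t] \<sigma>]
          bij_betw_trans[OF bij_betw_rotate[of "Suc i" t] \<tau>] i
        unfolding comp_def \<sigma>'_def \<tau>'_def by simp_all
      show "\<sigma>' 0 = x" using 2 by (simp add: \<sigma>'_def)
      have "Suc i + (t - 1) = i + t" using assms(2) by simp
      then show "\<tau>' (t - 1) = y" using 2 i by (simp add: \<tau>'_def)
      show "(\<sigma>' j, \<tau>' j) \<in> insert (x, y) E" if "j < t" for j
        using e1[of "(Suc i + j) mod t"] assms(2) by (simp add: \<sigma>'_def \<tau>'_def)
      show "(\<sigma>' (Suc j), \<tau>' j) \<in> insert (x, y) E" if "Suc j < t" for j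
        using e2[of "(Suc i + j) mod t"] assms(2) by (simp add: \<sigma>'_def \<tau>'_def mod_Suc_eq)
    qed
  qed
qed

text \<open>Otherwise \<open>E\<close> has a Hamilton path from \<open>x\<close> to
  \<open>y\<close>. The indices \<open>m\<close> with \<open>\<tau> m\<close> adjacent to
  \<open>x\<close> and those with \<open>\<sigma> m\<close> adjacent to \<open>y\<close> number at
  least \<open>t + 1\<close> in total, so some \<open>m\<close> is of both kinds; replacing the path
  edge between \<open>\<sigma> m\<close> and \<open>\<tau> m\<close> by the two chords closes the
  path to a cycle.\<close>

lemma bipartite_hamiltonian_remove_edge:
  assumes ham: "bipartite_hamiltonian t X Y (insert (x, y) E)" and t: "2 \<le> t"
    and deg: "t + 1 \<le> card {y' \<in> Y. (x, y') \<in> E} + card {x' \<in> X. (x', y) \<in> E}"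
  shows "bipartite_hamiltonian t X Y E"
proof (rule ccontr)
  assume "\<not> ?thesis"
  then obtain \<sigma> \<tau> where \<sigma>: "bij_betw \<sigma> {..<t} X" and \<tau>: "bij_betw \<tau> {..<t} Y"
    and x: "\<sigma> 0 = x" and y: "\<tau> (t - 1) = y"
    and e1: "\<forall>i<t. (\<sigma> i, \<tau> i) \<in> E" and e2: "\<forall>i. Suc i < t \<longrightarrow> (\<sigma> (Suc i), \<tau> i) \<in> E"
    using hamiltonian_path_of_insert[OF ham t] by blast
  define I where "I = {i. i < t \<and> (x, \<tau> i) \<in> E}"
  define K where "K = {i. i < t \<and> (\<sigma> i, y) \<in> E}"
  have "bij_betw \<tau> I {y' \<in> Y. (x, y') \<in> E}"
    using \<tau> unfolding bij_betw_def I_def by (auto simp: inj_on_def)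
  moreover have "bij_betw \<sigma> K {x' \<in> X. (x', y) \<in> E}"
    using \<sigma> unfolding bij_betw_def K_def by (auto simp: inj_on_def)
  ultimately have "card I + card K \<ge> t + 1" using deg by (simp add: bij_betw_same_card)
  moreover have "card (I \<union> K) \<le> t"
    using card_mono[of "{..<t}" "I \<union> K"] by (auto simp: I_def K_def)
  moreover have "finite I" "finite K" by (auto simp: I_def K_def)
  ultimately have "I \<inter> K \<noteq> {}" using card_Un_Int[of I K] by auto
  then obtain m where m: "m < t" "(x, \<tau> m) \<in> E" "(\<sigma> m, y) \<in> E" by (auto simp: I_def K_def)
  \<comment> \<open>The new cycle follows the path up to \<open>\<sigma> m\<close>, jumps to its end \<open>y\<close> and returns backwards to \<open>\<tau> m\<close>,
    which is adjacent to \<open>x\<close>.\<close>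
  define f where "f i = (if i \<le> m then i else t + m - i)" for i
  define g where "g i = (if i < m then i else t - 1 + m - i)" for i
  have f: "bij_betw f {..<t} {..<t}"
    by (rule bij_betw_lessThan_self) (use m in \<open>auto simp: f_def inj_on_def\<close>)
  have g: "bij_betw g {..<t} {..<t}"
    by (rule bij_betw_lessThan_self) (use m in \<open>auto simp: g_def inj_on_def\<close>)
  have "(\<sigma> (f i), \<tau> (g i)) \<in> E \<and> (\<sigma> (f ((i + 1) mod t)), \<tau> (g i)) \<in> E" if i: "i < t" for i
  proof
    consider "i < m" | "i = m" | "m < i" by linarith
    then show "(\<sigma> (f i), \<tau> (g i)) \<in> E"
    proof cases
      case 1 then show ?thesis using e1 i by (simp add: f_def g_def)
    next
      case 2 then show ?thesis using m y by (simp add: f_def g_def)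
    next
      case 3
      \<comment> \<open>Beyond \<open>m\<close> the path is run backwards, so this is its edge
        between \<open>\<sigma> (Suc l)\<close> and \<open>\<tau> l\<close> with
        \<open>l = t - 1 + m - i\<close>.\<close>
      then have "f i = Suc (t - 1 + m - i)" "g i = t - 1 + m - i" "Suc (t - 1 + m - i) < t"
        using i by (auto simp: f_def g_def)
      then show ?thesis using e2 by simp
    qed
    show "(\<sigma> (f ((i + 1) mod t)), \<tau> (g i)) \<in> E"
    proof (cases "Suc i = t")
      case True
      then have "g i = m" using m by (auto simp: g_def)
      then show ?thesis using True m x by (simp add: f_def)
    next
      case False
      then have i': "Suc i < t" using i by simp
      show ?thesis
      proof (cases "i < m")
        case True
        then show ?thesis using i' e2 by (simp add: f_def g_def)
      next
        case False
        then have "f (Suc i) = g i" "g i < t" using i' by (auto simp: f_def g_def)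
        then show ?thesis using i' e1 by simp
      qed
    qed
  qed
  then have "bipartite_hamiltonian t X Y E"
    unfolding bipartite_hamiltonian_def
    using bij_betw_trans[OF f \<sigma>] bij_betw_trans[OF g \<tau>]
    by (intro exI[of _ "\<sigma> \<circ> f"] exI[of _ "\<tau> \<circ> g"]) simp
  then show False using \<open>\<not> bipartite_hamiltonian t X Y E\<close> by blast
qed

text \<open>Adding all pairs of \<open>X \<times> Y\<close> to \<open>E\<close> gives a graph with
  an obvious Hamilton cycle; the added pairs are withdrawn one at a time by
  \<open>bipartite_hamiltonian_remove_edge\<close>. The degree condition holds throughout, since
  every intermediate graph contains \<open>E\<close>.\<close>

lemma moon_moser:
  assumes "finite X" "finite Y" "card X = t" "card Y = t" "2 \<le> t"
    and deg: "\<And>x y. x \<in> X \<Longrightarrow> y \<in> Y \<Longrightarrow> t + 1 \<le> card {y' \<in> Y. (x, y') \<in> E} + card {x' \<in> X. (x', y) \<in> E}"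
  shows "bipartite_hamiltonian t X Y E"
proof -
  have "bipartite_hamiltonian t X Y E"
    if "finite D" "D \<subseteq> X \<times> Y" "bipartite_hamiltonian t X Y (E \<union> D)" for D
    using that
  proof (induction D rule: finite_induct)
    case empty
    then show ?case by simp
  next
    case (insert p D)
    obtain x y where p: "p = (x, y)" "x \<in> X" "y \<in> Y" using insert.prems by auto
    have "bipartite_hamiltonian t X Y (E \<union> D)"
    proof (rule bipartite_hamiltonian_remove_edge[of t X Y x y])
      show "bipartite_hamiltonian t X Y (insert (x, y) (E \<union> D))" using insert.prems p by simp
      have "card {y' \<in> Y. (x, y') \<in> E} \<le> card {y' \<in> Y. (x, y') \<in> E \<union> D}"
        "card {x' \<in> X. (x', y) \<in> E} \<le> card {x' \<in> X. (x', y) \<in> E \<union> D}"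
        using assms(1,2) by (auto intro!: card_mono)
      then show "t + 1 \<le> card {y' \<in> Y. (x, y') \<in> E \<union> D} + card {x' \<in> X. (x', y) \<in> E \<union> D}"
        using deg[OF p(2,3)] by linarith
    qed fact
    then show ?case using insert.IH insert.prems(1) by blast
  qed
  moreover have "bipartite_hamiltonian t X Y (E \<union> X \<times> Y)"
  proof -
    obtain \<sigma> \<tau> where \<sigma>: "bij_betw \<sigma> {..<t} X" and \<tau>: "bij_betw \<tau> {..<t} Y"
      using ex_bij_betw_nat_finite[OF assms(1)] ex_bij_betw_nat_finite[OF assms(2)]
      unfolding assms(3,4) atLeast0LessThan by blast
    have "\<sigma> i \<in> X" "\<tau> i \<in> Y" if "i < t" for i
      using that bij_betwE[OF \<sigma>] bij_betwE[OF \<tau>] by simp_all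
    then have "\<forall>i<t. (\<sigma> i, \<tau> i) \<in> E \<union> X \<times> Y \<and> (\<sigma> ((i + 1) mod t), \<tau> i) \<in> E \<union> X \<times> Y"
      using \<open>2 \<le> t\<close> by simp
    then show ?thesis unfolding bipartite_hamiltonian_def using \<sigma> \<tau> by blast
  qed
  ultimately show ?thesis using finite_cartesian_product[OF assms(1,2)] by blast
qed

subsection \<open>Hamilton cycles in hypergraphs\<close>

text \<open>The blocks are listed in the order in which the cycle visits them. As they are fibres of
  \<open>c\<close>, disjointness comes from the injectivity of \<open>\<sigma>\<close> and
  \<open>\<tau>\<close> and from \<open>Inl\<close> and \<open>Inr\<close> never agreeing, and
  covering comes from surjectivity.\<close>

lemma hamilton_ab_cycle_of_coloring:
  assumes t: "1 \<le> t"
    and c: "c \<in> colorings V ({..<t} <+> {..<t}) (case_sum (\<lambda>_. a) (\<lambda>_. b))"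
    and ham: "bipartite_hamiltonian t {..<t} {..<t}
      {(i, j). {v \<in> V. c v = Inl i} \<union> {v \<in> V. c v = Inr j} \<in> H}"
  shows "has_hamilton_ab_cycle V H a b"
proof -
  let ?A = "\<lambda>i. {v \<in> V. c v = Inl i}"
  let ?B = "\<lambda>j. {v \<in> V. c v = Inr j}"
  obtain \<sigma> \<tau> where \<sigma>: "bij_betw \<sigma> {..<t} {..<t}" and \<tau>: "bij_betw \<tau> {..<t} {..<t}"
    and edges: "\<forall>i<t. (\<sigma> i, \<tau> i) \<in> {(i, j). ?A i \<union> ?B j \<in> H}
      \<and> (\<sigma> ((i + 1) mod t), \<tau> i) \<in> {(i, j). ?A i \<union> ?B j \<in> H}"
    using ham unfolding bipartite_hamiltonian_def by (elim exE conjE)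
  have mem: "\<sigma> i < t" "\<tau> i < t" if "i < t" for i
    using that bij_betw_apply[OF \<sigma>, of i] bij_betw_apply[OF \<tau>, of i] by simp_all
  have inj: "\<sigma> i \<noteq> \<sigma> j" "\<tau> i \<noteq> \<tau> j" if "i < t" "j < t" "i \<noteq> j" for i j
    using that inj_onD[OF bij_betw_imp_inj_on[OF \<sigma>], of i j]
      inj_onD[OF bij_betw_imp_inj_on[OF \<tau>], of i j] by auto
  have cards: "card (?A i) = a" "card (?B i) = b" if "i < t" for i
  proof -
    have "card {v \<in> V. c v = j} = case_sum (\<lambda>_. a) (\<lambda>_. b) j" if "j \<in> {..<t} <+> {..<t}" for j
      using c that unfolding colorings_def by blast
    from this[of "Inl i"] this[of "Inr i"] show "card (?A i) = a" "card (?B i) = b"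
      using that by auto
  qed
  have "(\<Union>i<t. ?A (\<sigma> i) \<union> ?B (\<tau> i)) = V"
  proof
    show "V \<subseteq> (\<Union>i<t. ?A (\<sigma> i) \<union> ?B (\<tau> i))"
    proof
      fix v assume v: "v \<in> V"
      then have "c v \<in> {..<t} <+> {..<t}" using c unfolding colorings_def by (auto simp: PiE_iff)
      then consider k where "k \<in> {..<t}" "c v = Inl k" | k where "k \<in> {..<t}" "c v = Inr k" by blast
      then show "v \<in> (\<Union>i<t. ?A (\<sigma> i) \<union> ?B (\<tau> i))"
      proof cases
        case 1
        then have "k \<in> \<sigma> ` {..<t}" unfolding bij_betw_imp_surj_on[OF \<sigma>] by simp
        then obtain i where "i < t" "\<sigma> i = k" by blast
        then show ?thesis using v 1 by auto
      next
        case 2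
        then have "k \<in> \<tau> ` {..<t}" unfolding bij_betw_imp_surj_on[OF \<tau>] by simp
        then obtain i where "i < t" "\<tau> i = k" by blast
        then show ?thesis using v 2 by auto
      qed
    qed
  qed auto
  moreover have "\<forall>i<t. ?A (\<sigma> i) \<union> ?B (\<tau> i) \<in> H \<and> ?B (\<tau> i) \<union> ?A (\<sigma> ((i + 1) mod t)) \<in> H"
    using edges by (simp add: Un_commute)
  moreover have "\<forall>i<t. \<forall>j<t. i \<noteq> j \<longrightarrow> ?A (\<sigma> i) \<inter> ?A (\<sigma> j) = {} \<and> ?B (\<tau> i) \<inter> ?B (\<tau> j) = {}"
    by (auto dest: inj)
  moreover have "\<forall>i<t. card (?A (\<sigma> i)) = a \<and> card (?B (\<tau> i)) = b"
    using cards mem by simp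
  moreover have "\<forall>i<t. \<forall>j<t. ?A (\<sigma> i) \<inter> ?B (\<tau> j) = {}" by auto
  ultimately show ?thesis
    unfolding has_hamilton_ab_cycle_def using t
    by (intro exI[of _ t] exI[of _ "\<lambda>i. ?A (\<sigma> i)"] exI[of _ "\<lambda>i. ?B (\<tau> i)"] conjI)
qed

lemma hamilton_ab_cycle_of_min_deg:
  fixes n k a b :: nat and V :: "'a set" and \<alpha> :: real
  assumes "0 < a" "0 < b" and V: "finite V" "card V = n"
    and "k dvd n" "5 * k \<le> n" "k = a + b"
    and "H \<subseteq> ksubsets V k"
    and degA: "real (min_deg V H a) \<ge> (\<alpha> + 4 * sqrt (real k * ln (real n) / real n)) * real ((n - a) choose b)"
    and degB: "real (min_deg V H b) \<ge> (1 - \<alpha> + 4 * sqrt (real k * ln (real n) / real n)) * real ((n - b) choose a)"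
  shows "has_hamilton_ab_cycle V H a b"
proof -
  obtain t where n: "n = k * t" using assms(5) by blast
  define s where "s = sqrt (real k * ln (real n) / real n)"
  have k2: "k \<ge> 2" using assms(1,2,7) by simp
  have t5: "t \<ge> 5" using k2 assms(6) by (simp add: n mult.commute)
  have n10: "n \<ge> 10" using k2 assms(6) by simp
  have ab: "a + b \<le> n" using assms(6,7) by simp
  have tn: "2 * t \<le> n" using k2 by (simp add: n)
  have ln1: "1 \<le> ln (real n)"
    using exp_le n10 by (subst ln_ge_iff) auto
  have s0: "0 \<le> s" using ln1 by (auto simp: s_def intro!: divide_nonneg_nonneg mult_nonneg_nonneg)
  \<comment> \<open>Because \<open>k / n = 1 / t\<close>.\<close>
  have s2: "s\<^sup>2 * real t = ln (real n)"
  proof -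
    have "s\<^sup>2 = real k * ln (real n) / real n" unfolding s_def
      using ln1 by (intro real_sqrt_pow2 divide_nonneg_nonneg mult_nonneg_nonneg) auto
    also have "\<dots> = ln (real n) / real t" using k2 by (simp add: n)
    finally show ?thesis using t5 by simp
  qed
  define \<epsilon> where "\<epsilon> = exp (s / 2 - 3 * s\<^sup>2 * real t)"
  \<comment> \<open>From 2s \<le> 1 + s^2, s^2 \<le> ln n and 1 \<le> ln n it follows that s/2 \<le>
    ln n, so \<open>\<epsilon>\<close> is at most 1/n^2; moreover \<open>2 * t \<le> n\<close>
    because \<open>k \<ge> 2\<close>.\<close>
  have \<epsilon>: "real (2 * t) * \<epsilon> < 1"
  proof -
    have "s\<^sup>2 * 1 \<le> s\<^sup>2 * real t" using t5 by (intro mult_left_mono) auto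
    moreover have "2 * s \<le> 1 + s\<^sup>2" using zero_le_power2[of "s - 1"] by (simp add: power2_diff)
    ultimately have "s / 2 - 3 * s\<^sup>2 * real t \<le> - ln (real n) - ln (real n)" using s2 ln1 by linarith
    then have "\<epsilon> \<le> exp (- ln (real n) - ln (real n))" by (simp add: \<epsilon>_def)
    also have "\<dots> = 1 / (real n * real n)" unfolding exp_diff exp_minus
      using n10 by (simp add: field_simps)
    finally have "real (2 * t) * \<epsilon> \<le> real n * (1 / (real n * real n))"
      using tn by (intro mult_mono) (auto simp del: of_nat_mult simp: \<epsilon>_def)
    also have "\<dots> < 1" using n10 by simp
    finally show ?thesis .
  qed
  \<comment> \<open>Labels \<open>Inl i\<close> stand for the blocks of size \<open>a\<close> and
    \<open>Inr j\<close> for those of size \<open>b\<close>; together they use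
    \<open>t * (a + b) = n\<close> vertices.\<close>
  define J where "J = {..<t} <+> {..<t}"
  define w where "w = (case_sum (\<lambda>_. a) (\<lambda>_. b) :: nat + nat \<Rightarrow> nat)"
  define C where "C = colorings V J w"
  have J: "finite J" by (simp add: J_def)
  have w: "sum w J = card V"
    unfolding J_def V(2) by (simp add: sum.Plus w_def n assms(7) algebra_simps)
  have Cpos: "0 < card C" unfolding C_def by (rule card_colorings_pos[OF V(1) J w])
  have Cfin: "finite C" unfolding C_def by (rule finite_colorings[OF V(1) J])
  let ?A = "\<lambda>c i. {v \<in> V. c v = Inl i}"
  let ?B = "\<lambda>c j. {v \<in> V. c v = Inr j}"
  define badA where "badA i = {c \<in> C. real (card {j. j < t \<and> ?A c i \<union> ?B c j \<in> H}) < \<alpha> * real t + 1 / 2}" for i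
  define badB where "badB j = {c \<in> C. real (card {i. i < t \<and> ?A c i \<union> ?B c j \<in> H}) < (1 - \<alpha>) * real t + 1 / 2}" for j
  have HV: "H \<subseteq> ksubsets V (a + b)" using assms(7,8) by simp
  have badA: "real (card (badA i)) \<le> real (card C) * \<epsilon>" if "i < t" for i
  proof -
    have "{x \<in> Inr ` {..<t}. ?A c i \<union> {v \<in> V. c v = x} \<in> H} = Inr ` {j. j < t \<and> ?A c i \<union> ?B c j \<in> H}"
      for c :: "'a \<Rightarrow> nat + nat" by auto
    then have eq: "card {x \<in> Inr ` {..<t}. ?A c i \<union> {v \<in> V. c v = x} \<in> H}
        = card {j. j < t \<and> ?A c i \<union> ?B c j \<in> H}" for c :: "'a \<Rightarrow> nat + nat"
      by (simp add: card_image)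
    have card_t: "card ((Inr :: nat \<Rightarrow> nat + nat) ` {..<t}) = t" by (simp add: card_image)
    \<comment> \<open>Block \<open>Inl i\<close> is tested against all \<open>Inr\<close> blocks.
      Its link lives on the remaining \<open>n - a\<close> vertices, which matches the binomial
      coefficient in \<open>degA\<close>.\<close>
    have "real (card {c \<in> colorings V J w. real (card {x \<in> Inr ` {..<t}.
          ?A c i \<union> {v \<in> V. c v = x} \<in> H}) < \<alpha> * real (card ((Inr :: nat \<Rightarrow> nat + nat) ` {..<t})) + 1 / 2})
        \<le> real (card (colorings V J w)) * exp (s / 2 - 3 * s\<^sup>2 * real (card ((Inr :: nat \<Rightarrow> nat + nat) ` {..<t})))"
    proof (rule card_colorings_link_tail[OF V(1) J w])
      fix S assume "S \<in> ksubsets V (w (Inl i))"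
      then have S: "S \<in> ksubsets V a" by (simp add: w_def)
      have "(\<alpha> + 4 * s) * real ((card V - w (Inl i)) choose b) \<le> real (min_deg V H a)"
        using degA by (simp add: V w_def s_def)
      also have "\<dots> \<le> real (hdeg H S)" using min_deg_le_hdeg[OF V(1) S] by simp
      finally show "(\<alpha> + 4 * s) * real ((card V - w (Inl i)) choose b)
          \<le> real (card (ksubsets (V - S) b \<inter> {B. S \<union> B \<in> H}))"
        unfolding hdeg_eq_card_link[OF V(1) HV S] .
    qed (use that ab s0 V in \<open>auto simp: J_def w_def\<close>)
    then show ?thesis unfolding eq card_t badA_def C_def \<epsilon>_def .
  qed
  have badB: "real (card (badB j)) \<le> real (card C) * \<epsilon>" if "j < t" for j
  proof -
    have "{x \<in> Inl ` {..<t}. ?B c j \<union> {v \<in> V. c v = x} \<in> H} = Inl ` {i. i < t \<and> ?A c i \<union> ?B c j \<in> H}"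
      for c :: "'a \<Rightarrow> nat + nat" by (auto simp: Un_commute)
    then have eq: "card {x \<in> Inl ` {..<t}. ?B c j \<union> {v \<in> V. c v = x} \<in> H}
        = card {i. i < t \<and> ?A c i \<union> ?B c j \<in> H}" for c :: "'a \<Rightarrow> nat + nat"
      by (simp add: card_image)
    have card_t: "card ((Inl :: nat \<Rightarrow> nat + nat) ` {..<t}) = t" by (simp add: card_image)
    have HV': "H \<subseteq> ksubsets V (b + a)" using HV by (simp add: add.commute)
    have "real (card {c \<in> colorings V J w. real (card {x \<in> Inl ` {..<t}.
          ?B c j \<union> {v \<in> V. c v = x} \<in> H}) < (1 - \<alpha>) * real (card ((Inl :: nat \<Rightarrow> nat + nat) ` {..<t})) + 1 / 2})
        \<le> real (card (colorings V J w)) * exp (s / 2 - 3 * s\<^sup>2 * real (card ((Inl :: nat \<Rightarrow> nat + nat) ` {..<t})))"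
    proof (rule card_colorings_link_tail[OF V(1) J w])
      fix S assume "S \<in> ksubsets V (w (Inr j))"
      then have S: "S \<in> ksubsets V b" by (simp add: w_def)
      have "(1 - \<alpha> + 4 * s) * real ((card V - w (Inr j)) choose a) \<le> real (min_deg V H b)"
        using degB by (simp add: V w_def s_def)
      also have "\<dots> \<le> real (hdeg H S)" using min_deg_le_hdeg[OF V(1) S] by simp
      finally show "(1 - \<alpha> + 4 * s) * real ((card V - w (Inr j)) choose a)
          \<le> real (card (ksubsets (V - S) a \<inter> {B. S \<union> B \<in> H}))"
        unfolding hdeg_eq_card_link[OF V(1) HV' S] .
    qed (use that ab s0 V in \<open>auto simp: J_def w_def\<close>)
    then show ?thesis unfolding eq card_t badB_def C_def \<epsilon>_def .
  qed
  \<comment> \<open>Union bound: each of the \<open>2 * t\<close> bad sets is at most a fraction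
    \<open>\<epsilon>\<close> of \<open>C\<close>.\<close>
  have "\<exists>c\<in>C. \<forall>i<t. c \<notin> badA i \<and> c \<notin> badB i"
  proof (rule ccontr)
    assume "\<not> ?thesis"
    then have "C \<subseteq> (\<Union>i<t. badA i \<union> badB i)" by auto
    moreover have "finite (\<Union>i<t. badA i \<union> badB i)"
      using Cfin by (auto simp: badA_def badB_def)
    ultimately have "card C \<le> card (\<Union>i<t. badA i \<union> badB i)" by (simp add: card_mono)
    also have "\<dots> \<le> (\<Sum>i<t. card (badA i \<union> badB i))" by (rule card_UN_le) simp
    also have "\<dots> \<le> (\<Sum>i<t. card (badA i) + card (badB i))" by (intro sum_mono card_Un_le)
    finally have "real (card C) \<le> real (\<Sum>i<t. card (badA i) + card (badB i))"
      by (simp only: of_nat_le_iff)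
    also have "\<dots> = (\<Sum>i<t. real (card (badA i)) + real (card (badB i)))" by simp
    also have "\<dots> \<le> (\<Sum>i<t. real (card C) * \<epsilon> + real (card C) * \<epsilon>)"
      by (intro sum_mono add_mono) (use badA badB in auto)
    also have "\<dots> = real (card C) * (real (2 * t) * \<epsilon>)" by simp
    also have "\<dots> < real (card C) * 1" using \<epsilon> Cpos by (intro mult_strict_left_mono) auto
    finally show False by simp
  qed
  then obtain c where c: "c \<in> C" and good: "\<And>i. i < t \<Longrightarrow> c \<notin> badA i \<and> c \<notin> badB i" by blast
  have "bipartite_hamiltonian t {..<t} {..<t} {(i, j). ?A c i \<union> ?B c j \<in> H}"
  proof (rule moon_moser)
    fix i j assume "i \<in> {..<t}" "j \<in> {..<t}"
    then have "c \<notin> badA i" "c \<notin> badB j" using good by auto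
    then have "\<alpha> * real t + 1 / 2 \<le> real (card {j. j < t \<and> ?A c i \<union> ?B c j \<in> H})"
      "(1 - \<alpha>) * real t + 1 / 2 \<le> real (card {i. i < t \<and> ?A c i \<union> ?B c j \<in> H})"
      using c unfolding badA_def badB_def by auto
    \<comment> \<open>The terms in \<open>\<alpha>\<close> cancel and the two halves make 1, exactly
      the degree sum that \<open>moon_moser\<close> asks for.\<close>
    then have "real t + 1 \<le> real (card {j. j < t \<and> ?A c i \<union> ?B c j \<in> H})
        + real (card {i. i < t \<and> ?A c i \<union> ?B c j \<in> H})"
      by (simp add: algebra_simps)
    then have "t + 1 \<le> card {j. j < t \<and> ?A c i \<union> ?B c j \<in> H} + card {i. i < t \<and> ?A c i \<union> ?B c j \<in> H}"
      by linarith
    then show "t + 1 \<le> card {y' \<in> {..<t}. (i, y') \<in> {(i, j). ?A c i \<union> ?B c j \<in> H}}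
        + card {x' \<in> {..<t}. (x', j) \<in> {(i, j). ?A c i \<union> ?B c j \<in> H}}"
      by (simp only: mem_Collect_eq prod.case lessThan_iff)
  qed (use t5 in auto)
  then show ?thesis
    using t5 c unfolding C_def J_def w_def by (intro hamilton_ab_cycle_of_coloring) auto
qed

theorem theorem1p1:
  fixes n k a b :: nat and H :: "nat set set"
  assumes "n > 0" "k > 0" "a > 0" "b > 0"
    and "k dvd n" "n \<ge> 5 * k" "k = a + b"
    and "H \<subseteq> ksubsets {1..n} k"
    and "\<exists>\<alpha>::real. 0 < \<alpha> \<and> \<alpha> < 1 \<and>
          real (min_deg {1..n} H a) \<ge> (\<alpha> + 4 * sqrt (real k * ln (real n) / real n)) * real ((n - a) choose b) \<and>
          real (min_deg {1..n} H b) \<ge> (1 - \<alpha> + 4 * sqrt (real k * ln (real n) / real n)) * real ((n - b) choose a)"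
  shows "has_hamilton_ab_cycle {1..n} H a b"
proof -
  from assms(9) obtain \<alpha> where
    degA: "real (min_deg {1..n} H a) \<ge> (\<alpha> + 4 * sqrt (real k * ln (real n) / real n)) * real ((n - a) choose b)"
    and degB: "real (min_deg {1..n} H b) \<ge> (1 - \<alpha> + 4 * sqrt (real k * ln (real n) / real n)) * real ((n - b) choose a)"
    by blast
  show ?thesis
    by (rule hamilton_ab_cycle_of_min_deg[OF assms(3,4) _ _ assms(5-8) degA degB]) simp_all
qed

end
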